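(* Let $d\geq 1$ and let $T_1,\dots,T_d$ be trees, each with at least one edge. Let $G:=T_1\square T_2\square\cdots\square T_d$ be their cartesian product, and let $G^2$ be the square of $G$. Then $$1+\sum_{i=1}^d \Delta(T_i)\;\leq\;\chi(G^2)\;\leq\; 1+2\sum_{i=1}^d \left\lceil \tfrac{1}{2}\Delta(T_i)\right\rceil .$$
   Context: Graphs are finite and simple. $\Delta(G)$ denotes the maximum degree of a graph $G$. A colouring of a graph $G$ is a function $c:V(G)\to\mathbb{Z}$ such that $c(v)\neq c(w)$ for every edge $vw$ of $G$; $\chi(G)$ is the chromatic number, i.e. the minimum number of distinct colours used in a colouring of $G$. The square $G^2$ of $G$ is the graph with vertex set $V(G)$ in which two distinct vertices are adjacent whenever they are adjacent in $G$ or have a common neighbour in $G$. The cartesian product $G_1\square\cdots\square G_d$ of graphs $G_1,\dots,G_d$ is the graph with vertex set $\{(v_1,\dots,v_d): v_i\in V(G_i)\}$, where $v=(v_1,\dots,v_d)$ and $w=(w_1,\dots,w_d)$ are adjacent whenever for some $i\in\{1,\dots,d\}$ we have $v_iw_i\in E(G_i)$ and $v_j=w_j$ for all $j\neq i$. *)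

theory Defs
  imports Complex_Main "Graph_Theory.Pair_Digraph" "Graph_Theory.Digraph_Component"
begin

text \<open>
  A finite simple graph is a \<^locale>\<open>pair_graph\<close>: a finite, loopless digraph without parallel
  arcs whose arc relation is symmetric. An edge \<open>uv\<close> is the pair of arcs \<open>(u, v)\<close>, \<open>(v, u)\<close>.
\<close>

text \<open>
  The constant \<^const>\<open>tree\<close> of the library forbids all directed cycles, and so rejects every
  symmetric digraph that has an edge (\<open>u, v, u\<close> is a directed cycle). In a symmetric loopless
  digraph, the directed cycles of length at least 3 are the cycles of the undirected graph.
\<close>

definition undirected_tree :: "'a pair_pre_digraph \<Rightarrow> bool" where
  "undirected_tree G \<longleftrightarrow>
     pair_graph G \<and> Digraph_Component.connected (with_proj G) \<and>
     \<not> (\<exists>p. pre_digraph.cycle (with_proj G) p \<and> 3 \<le> length p)"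

text \<open>In a symmetric digraph without parallel arcs the out-degree is the number of neighbours.\<close>

definition max_degree :: "'a pair_pre_digraph \<Rightarrow> nat" where
  "max_degree G = Max (out_degree (with_proj G) ` pverts G)"

definition colouring :: "'a pair_pre_digraph \<Rightarrow> ('a \<Rightarrow> int) \<Rightarrow> bool" where
  "colouring G c \<longleftrightarrow> (\<forall>(v, w) \<in> parcs G. c v \<noteq> c w)"

definition chromatic_number :: "'a pair_pre_digraph \<Rightarrow> nat" where
  "chromatic_number G = (LEAST k. \<exists>c. colouring G c \<and> card (c ` pverts G) = k)"

definition square :: "'a pair_pre_digraph \<Rightarrow> 'a pair_pre_digraph" where
  "square G =
     \<lparr> pverts = pverts G,
       parcs = {(v, w). v \<in> pverts G \<and> w \<in> pverts G \<and> v \<noteq> w \<and>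
                  ((v, w) \<in> parcs G \<or>
                   (\<exists>u \<in> pverts G. (v, u) \<in> parcs G \<and> (w, u) \<in> parcs G))} \<rparr>"

text \<open>
  Tuples indexed by \<open>I\<close> are extensional functions, so that \<open>I\<close>-tuples are equal iff their
  components are.
\<close>

definition cartesian_product ::
    "'i set \<Rightarrow> ('i \<Rightarrow> 'a pair_pre_digraph) \<Rightarrow> ('i \<Rightarrow> 'a) pair_pre_digraph" where
  "cartesian_product I G =
     \<lparr> pverts = (\<Pi>\<^sub>E i\<in>I. pverts (G i)),
       parcs = {(v, w). v \<in> (\<Pi>\<^sub>E i\<in>I. pverts (G i)) \<and> w \<in> (\<Pi>\<^sub>E i\<in>I. pverts (G i)) \<and>
                  (\<exists>i\<in>I. (v i, w i) \<in> parcs (G i) \<and> (\<forall>j\<in>I. j \<noteq> i \<longrightarrow> v j = w j))} \<rparr>"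

lemma pair_graphI:
  assumes "finite (pverts G)" "parcs G \<subseteq> pverts G \<times> pverts G"
    and "\<And>v w. (v, w) \<in> parcs G \<Longrightarrow> (w, v) \<in> parcs G" "\<And>v. (v, v) \<notin> parcs G"
  shows "pair_graph G"
proof -
  have "finite (parcs G)"
    by (rule finite_subset[OF assms(2) finite_cartesian_product[OF assms(1) assms(1)]])
  moreover have "sym (parcs G)"
    using assms(3) by (rule symI)
  ultimately show ?thesis
    using assms by unfold_locales (auto simp: symmetric_def)
qed

lemma pair_graph_square:
  assumes "pair_graph G"
  shows "pair_graph (square G)"
proof -
  interpret pair_graph G by fact
  show ?thesis
    by (rule pair_graphI) (auto simp: square_def intro: arcs_symmetric)
qed

lemma pair_graph_cartesian_product:
  assumes "finite I" "\<And>i. i \<in> I \<Longrightarrow> pair_graph (G i)"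
  shows "pair_graph (cartesian_product I G)"
proof (rule pair_graphI)
  have "finite (pverts (G i))" if "i \<in> I" for i
  proof -
    interpret pair_graph "G i" using assms(2) that .
    show ?thesis by (rule pair_finite_verts)
  qed
  then show "finite (pverts (cartesian_product I G))"
    using assms(1) by (simp add: cartesian_product_def finite_PiE)
next
  show "parcs (cartesian_product I G)
      \<subseteq> pverts (cartesian_product I G) \<times> pverts (cartesian_product I G)"
    by (auto simp: cartesian_product_def)
next
  fix v w assume vw: "(v, w) \<in> parcs (cartesian_product I G)"
  then obtain i where i: "i \<in> I" "(v i, w i) \<in> parcs (G i)" "\<forall>j\<in>I. j \<noteq> i \<longrightarrow> v j = w j"
    by (auto simp: cartesian_product_def)
  interpret pair_graph "G i" using assms(2) i(1) .
  have "(w i, v i) \<in> parcs (G i)"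
    using i(2) by (rule arcs_symmetric)
  then show "(w, v) \<in> parcs (cartesian_product I G)"
    using vw i by (auto simp: cartesian_product_def)
next
  fix v show "(v, v) \<notin> parcs (cartesian_product I G)"
  proof
    assume "(v, v) \<in> parcs (cartesian_product I G)"
    then obtain i where i: "i \<in> I" "(v i, v i) \<in> parcs (G i)"
      by (auto simp: cartesian_product_def)
    interpret pair_graph "G i" using assms(2) i(1) .
    show False using pair_no_loops[OF i(2)] by simp
  qed
qed

end

theory Submission
  imports Defs
begin

text \<open>
  Lower bound: the neighbours of a vertex \<open>v\<close> of \<open>G\<close> pairwise share the neighbour \<open>v\<close>, so \<open>v\<close> and
  its neighbours form a clique of \<open>G\<^sup>2\<close>, and every colouring of \<open>G\<^sup>2\<close> uses at least \<open>1 + deg v\<close>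
  colours (\<open>Suc_out_degree_le_chromatic_number_square\<close>). Degrees add up in a cartesian product
  (\<open>out_degree_cartesian_product\<close>), so one takes \<open>v\<close> to have maximum degree in every coordinate.

  Upper bound: put \<open>k\<^sub>i = \<lceil>\<Delta>(T\<^sub>i) / 2\<rceil>\<close> and \<open>M = 1 + 2 \<Sum> k\<^sub>i\<close>. The nonzero residues modulo \<open>M\<close> are
  represented by the integers \<open>s\<close> with \<open>1 \<le> \<bar>s\<bar> \<le> \<Sum> k\<^sub>i\<close>. Cutting the range of \<open>\<bar>s\<bar>\<close> into
  consecutive intervals of lengths \<open>k\<^sub>1, \<dots>, k\<^sub>d\<close> splits these residues into disjoint sets
  \<open>S\<^sub>1, \<dots>, S\<^sub>d\<close>, where \<open>S\<^sub>i = - S\<^sub>i\<close> and \<open>S\<^sub>i\<close> has \<open>2 k\<^sub>i \<ge> \<Delta>(T\<^sub>i)\<close> elements. Since \<open>T\<^sub>i\<close> is a tree,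
  its vertices can be labelled greedily, from any starting vertex outwards, such that at every
  vertex \<open>v\<close> the neighbours carry distinct labels, each differing from the label of \<open>v\<close> by an element
  of \<open>S\<^sub>i\<close> (\<open>undirected_tree_difference_labelling\<close>): as there are no cycles, a new vertex is
  adjacent to only one labelled vertex \<open>q\<close>, so its label only has to avoid the fewer than
  \<open>\<Delta>(T\<^sub>i)\<close> elements of \<open>S\<^sub>i\<close> already used at \<open>q\<close>. The condition at the new vertex itself holds
  because \<open>S\<^sub>i\<close> is symmetric.

  Now colour a tuple by the sum of the labels of its coordinates modulo \<open>M\<close>. A step along an edge
  of \<open>G\<close> in coordinate \<open>i\<close> changes the colour by an element of \<open>S\<^sub>i\<close>, which is nonzero; and two steps
  from a common vertex that lead to the same colour use the same element of the union of the
  \<open>S\<^sub>i\<close>, hence the same coordinate, hence end at the same vertex. So this is a colouring of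
  \<open>G\<^sup>2\<close> with at most \<open>M\<close> colours.
\<close>

section \<open>Degrees\<close>

lemma out_degree_eq_card_Image: "out_degree (with_proj G) v = card (parcs G `` {v})"
proof -
  have "out_arcs (with_proj G) v = Pair v ` (parcs G `` {v})"
    by (auto simp: out_arcs_def)
  then show ?thesis
    by (simp add: out_degree_def card_image inj_on_def)
qed

lemma (in pair_graph) finite_Image_parcs: "finite (parcs G `` {v})"
  by (rule finite_subset[OF _ pair_finite_verts]) (auto dest: in_arcsD2)

lemma (in pair_graph) out_degree_le_max_degree:
  assumes "v \<in> pverts G"
  shows "out_degree (with_proj G) v \<le> max_degree G"
  using assms pair_finite_verts by (simp add: max_degree_def)

lemma (in pair_graph) max_degree_attained:
  assumes "pverts G \<noteq> {}"
  obtains v where "v \<in> pverts G" "out_degree (with_proj G) v = max_degree G"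
proof -
  have "max_degree G \<in> out_degree (with_proj G) ` pverts G"
    unfolding max_degree_def using assms pair_finite_verts by (intro Max_in) auto
  then show ?thesis
    using that by force
qed

lemma out_degree_cartesian_product:
  assumes "finite I" and G: "\<And>i. i \<in> I \<Longrightarrow> pair_graph (G i)"
    and v: "v \<in> pverts (cartesian_product I G)"
  shows "out_degree (with_proj (cartesian_product I G)) v
    = (\<Sum>i\<in>I. out_degree (with_proj (G i)) (v i))"
proof -
  let ?N = "\<lambda>i. parcs (G i) `` {v i}"
  have vP: "v \<in> (\<Pi>\<^sub>E i\<in>I. pverts (G i))"
    using v by (simp add: cartesian_product_def)
  have "parcs (cartesian_product I G) `` {v} = (\<lambda>(i, u). v(i := u)) ` (SIGMA i:I. ?N i)"
    (is "?L = ?R")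
  proof
    show "?L \<subseteq> ?R"
    proof
      fix w assume "w \<in> ?L"
      then obtain i where i: "i \<in> I" "(v i, w i) \<in> parcs (G i)" "\<forall>j\<in>I. j \<noteq> i \<longrightarrow> v j = w j"
        and wP: "w \<in> (\<Pi>\<^sub>E i\<in>I. pverts (G i))"
        by (auto simp: cartesian_product_def)
      have "w = v(i := w i)"
      proof (rule PiE_ext[OF wP])
        show "v(i := w i) \<in> (\<Pi>\<^sub>E i\<in>I. pverts (G i))"
          using vP wP i(1) by (auto simp: PiE_iff extensional_def)
      qed (use i in auto)
      then show "w \<in> ?R"
        using i by (intro image_eqI[of _ _ "(i, w i)"]) auto
    qed
    show "?R \<subseteq> ?L"
    proof clarify
      fix i u assume i: "i \<in> I" "(v i, u) \<in> parcs (G i)"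
      interpret pair_graph "G i" by (rule G[OF i(1)])
      have "v(i := u) \<in> (\<Pi>\<^sub>E i\<in>I. pverts (G i))"
        using vP i in_arcsD2[OF i(2)] by (auto simp: PiE_iff extensional_def)
      then show "(v, v(i := u)) \<in> parcs (cartesian_product I G)"
        using vP i by (auto simp: cartesian_product_def)
    qed
  qed
  moreover have "inj_on (\<lambda>(i, u). v(i := u)) (SIGMA i:I. ?N i)"
  proof (rule inj_onI, clarify)
    fix i u j u' assume i: "i \<in> I" "(v i, u) \<in> parcs (G i)"
      and j: "j \<in> I" "(v j, u') \<in> parcs (G j)" and eq: "v(i := u) = v(j := u')"
    \<comment> \<open>No arc is a loop, so the modified coordinate is the one where the tuple differs from \<open>v\<close>.\<close>
    have "u \<noteq> v i"
      using pair_loopfree_digraph.pair_no_loops[of "G i"] G[OF i(1)] i(2)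
      by (fastforce simp: pair_graph_def pair_digraph_def)
    then have "i = j"
      using fun_cong[OF eq, of i] by (auto split: if_splits)
    then show "i = j \<and> u = u'"
      using fun_cong[OF eq, of i] by simp
  qed
  ultimately have "card (parcs (cartesian_product I G) `` {v}) = card (SIGMA i:I. ?N i)"
    by (simp add: card_image)
  also have "\<dots> = (\<Sum>i\<in>I. card (?N i))"
    using assms(1) G by (intro card_SigmaI) (auto intro: pair_graph.finite_Image_parcs)
  finally show ?thesis
    by (simp add: out_degree_eq_card_Image)
qed

section \<open>Chromatic number of a square\<close>

lemma (in pair_graph) chromatic_number_attained:
  obtains c where "colouring G c" "card (c ` pverts G) = chromatic_number G"
proof -
  obtain f :: "'a \<Rightarrow> nat" where f: "inj_on f (pverts G)"
    using finite_imp_inj_to_nat_seg[OF pair_finite_verts] by blast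
  have "colouring G (\<lambda>v. int (f v))"
    using f in_arcsD1 in_arcsD2 pair_no_loops
    by (fastforce simp: colouring_def dest: inj_onD)
  then have "\<exists>k c. colouring G c \<and> card (c ` pverts G) = k"
    by blast
  then have "\<exists>c. colouring G c \<and> card (c ` pverts G) = chromatic_number G"
    unfolding chromatic_number_def by (rule LeastI_ex)
  then show ?thesis
    using that by blast
qed

lemma chromatic_number_le:
  assumes "colouring G c" "c ` pverts G \<subseteq> C" "finite C"
  shows "chromatic_number G \<le> card C"
proof -
  have "chromatic_number G \<le> card (c ` pverts G)"
    unfolding chromatic_number_def using assms(1) by (intro Least_le) blast
  then show ?thesis
    using card_mono[OF assms(3,2)] by linarith
qed

text \<open>A vertex and its neighbours form a clique of the square.\<close>

lemma Suc_out_degree_le_chromatic_number_square: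
  assumes "pair_graph G" and v: "v \<in> pverts G"
  shows "1 + out_degree (with_proj G) v \<le> chromatic_number (square G)"
proof -
  interpret pair_graph G by fact
  interpret sq: pair_graph "square G" using assms(1) by (rule pair_graph_square)
  obtain c where c: "colouring (square G) c"
      "card (c ` pverts (square G)) = chromatic_number (square G)"
    using sq.chromatic_number_attained .
  let ?Q = "insert v (parcs G `` {v})"
  have Q: "?Q \<subseteq> pverts (square G)"
    using v by (auto simp: square_def dest: in_arcsD2)
  have "(x, y) \<in> parcs (square G)" if "x \<in> ?Q" "y \<in> ?Q" "x \<noteq> y" for x y
    using that v by (auto simp: square_def dest: in_arcsD2 arcs_symmetric)
  then have "inj_on c ?Q"
    using c(1) unfolding inj_on_def colouring_def by blast
  then have "card ?Q = card (c ` ?Q)"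
    by (rule card_image[symmetric])
  also have "\<dots> \<le> chromatic_number (square G)"
    unfolding c(2)[symmetric] using Q sq.pair_finite_verts by (intro card_mono) auto
  finally have "card ?Q \<le> chromatic_number (square G)" .
  moreover have "v \<notin> parcs G `` {v}"
    using pair_no_loops[of "(v, v)"] by auto
  ultimately show ?thesis
    using finite_Image_parcs[of v] by (simp add: out_degree_eq_card_Image)
qed

section \<open>Growing a tree vertex by vertex\<close>

context pair_graph
begin

definition path_connected_within :: "'a set \<Rightarrow> bool" where
  "path_connected_within X \<longleftrightarrow>
     (\<forall>y\<in>X. \<forall>z\<in>X. \<exists>p. apath y p z \<and> set (pawalk_verts y p) \<subseteq> X)"

lemma path_connected_within_insert:
  assumes X: "path_connected_within X" and q: "q \<in> X" and x: "x \<notin> X" and qx: "(q, x) \<in> parcs G"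
  shows "path_connected_within (insert x X)"
  unfolding path_connected_within_def
proof (intro ballI)
  have xq: "(x, q) \<in> parcs G" using qx by (rule arcs_symmetric)
  have xV: "x \<in> pverts G" using qx by (rule in_arcsD2)
  have path: "\<exists>p. apath y p z \<and> set (pawalk_verts y p) \<subseteq> X" if "y \<in> X" "z \<in> X" for y z
    using X that unfolding path_connected_within_def by blast
  fix y z assume "y \<in> insert x X" "z \<in> insert x X"
  then consider "y \<in> X" "z \<in> X" | "y = x" "z \<in> X" | "y \<in> X" "z = x" | "y = x" "z = x"
    by auto
  then show "\<exists>p. apath y p z \<and> set (pawalk_verts y p) \<subseteq> insert x X"
  proof cases
    case 1
    then show ?thesis using path by blast
  next
    case 2
    then obtain p where p: "apath q p z" "set (pawalk_verts q p) \<subseteq> X"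
      using path q by blast
    then have "apath x ((x, q) # p) z"
      using xq x by (auto simp: apath_Cons_iff)
    then show ?thesis
      using p 2 by (intro exI[of _ "(x, q) # p"]) auto
  next
    case 3
    then obtain p where p: "apath y p q" "set (pawalk_verts y p) \<subseteq> X"
      using path q by blast
    then have last: "last (pawalk_verts y p) = q" and walk: "awalk y p q"
      by (auto simp: apath_def)
    have walk': "awalk y (p @ [(q, x)]) x"
      using walk qx xV last by (simp add: awalk_Cons_iff awalk_Nil_iff)
    then have verts: "pawalk_verts y (p @ [(q, x)]) = pawalk_verts y p @ [x]"
      using awalk_verts_append[OF walk'] by simp
    then have "apath y (p @ [(q, x)]) x"
      using walk' p x by (auto simp: apath_def)
    then show ?thesis
      using p verts 3 by (intro exI[of _ "p @ [(q, x)]"]) auto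
  next
    case 4
    then show ?thesis
      using xV by (intro exI[of _ "[]"]) (auto simp: apath_Nil_iff)
  qed
qed

text \<open>A path inside \<open>X\<close> between two neighbours of \<open>x\<close> closes up through \<open>x\<close> to a cycle.\<close>

lemma unique_neighbour_within:
  assumes acyclic: "\<not> (\<exists>p. cycle p \<and> 3 \<le> length p)"
    and X: "path_connected_within X" and x: "x \<notin> X"
    and y: "y \<in> X" "(y, x) \<in> parcs G" and z: "z \<in> X" "(z, x) \<in> parcs G"
  shows "y = z"
proof (rule ccontr)
  assume "y \<noteq> z"
  obtain p where p: "apath y p z" "set (pawalk_verts y p) \<subseteq> X"
    using X y(1) z(1) unfolding path_connected_within_def by blast
  have last: "last (pawalk_verts y p) = z" and walk: "awalk y p z"
    using p by (auto simp: apath_def)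
  have xV: "x \<in> pverts G" using y(2) by (rule in_arcsD2)
  have walk': "awalk y (p @ [(z, x)]) x"
    using walk z(2) xV last by (simp add: awalk_Cons_iff awalk_Nil_iff)
  have verts: "pawalk_verts y (p @ [(z, x)]) = pawalk_verts y p @ [x]"
    using awalk_verts_append[OF walk'] by simp
  have "p \<noteq> []"
    using \<open>y \<noteq> z\<close> p(1) by (auto simp: apath_Nil_iff)
  then have "3 \<le> length ((x, y) # p @ [(z, x)])"
    by (cases p) auto
  moreover have "cycle ((x, y) # p @ [(z, x)])"
    unfolding cycle_def
    using walk' arcs_symmetric[OF y(2)] verts p x
    by (intro exI[of _ x]) (auto simp: awalk_Cons_iff apath_def)
  ultimately show False
    using acyclic by blast
qed

lemma awalk_crosses_boundary:
  assumes "awalk r p x" "r \<in> X" "x \<notin> X"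
  shows "\<exists>u v. u \<in> X \<and> v \<notin> X \<and> (u, v) \<in> parcs G"
  using assms
proof (induction p arbitrary: r)
  case Nil
  then show ?case by (simp add: awalk_Nil_iff)
next
  case (Cons e p)
  then have e: "e \<in> parcs G" "r = fst e" "awalk (snd e) p x"
    by (auto simp: awalk_Cons_iff)
  show ?case
  proof (cases "snd e \<in> X")
    case True
    then show ?thesis using Cons e by blast
  next
    case False
    then show ?thesis using e Cons.prems by (intro exI[of _ "fst e"] exI[of _ "snd e"]) auto
  qed
qed

end

text \<open>
  The vertices of a tree can be added one at a time such that each new vertex \<open>x\<close> has a single
  neighbour \<open>q\<close> among the previous ones. To that end, a largest path-connected set of vertices with
  property \<open>P\<close> is extended across its boundary as long as it misses a vertex.
\<close>

lemma undirected_tree_induct [consumes 1, case_names single extend]: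
  assumes T: "undirected_tree G"
    and single: "\<And>r. r \<in> pverts G \<Longrightarrow> P {r}"
    and extend: "\<And>X q x. \<lbrakk>X \<subseteq> pverts G; q \<in> X; x \<in> pverts G - X; (q, x) \<in> parcs G;
      \<And>y. \<lbrakk>y \<in> X; (y, x) \<in> parcs G\<rbrakk> \<Longrightarrow> y = q; P X\<rbrakk> \<Longrightarrow> P (insert x X)"
  shows "P (pverts G)"
proof -
  interpret pair_graph G
    using T by (simp add: undirected_tree_def)
  have acyclic: "\<not> (\<exists>p. cycle p \<and> 3 \<le> length p)"
    using T by (simp add: undirected_tree_def)
  have conn: "strongly_connected (mk_symmetric (with_proj G))"
    using T by (simp add: undirected_tree_def Digraph_Component.connected_def)
  have walk: "\<exists>p. awalk u p v" if "u \<in> pverts G" "v \<in> pverts G" for u v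
  proof -
    have "u \<rightarrow>\<^sup>*\<^bsub>mk_symmetric (with_proj G)\<^esub> v"
      using conn that by (auto simp: strongly_connected_def)
    then have "u \<rightarrow>\<^sup>*\<^bsub>with_proj G\<^esub> v"
      using reachable_mk_symmetric_eq[OF pair_sym_arcs] by simp
    then show ?thesis
      by (simp add: reachable_awalk)
  qed
  define A where "A = {X. X \<subseteq> pverts G \<and> X \<noteq> {} \<and> path_connected_within X \<and> P X}"
  obtain r where r: "r \<in> pverts G"
    using conn by (auto simp: strongly_connected_def)
  have "path_connected_within {r}"
    using r unfolding path_connected_within_def
    by (auto intro!: exI[of _ "[]"] simp: apath_Nil_iff)
  then have "{r} \<in> A"
    using r single by (simp add: A_def)
  moreover have "finite A"
    by (rule finite_subset[of _ "Pow (pverts G)"]) (auto simp: A_def pair_finite_verts)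
  ultimately obtain X where XA: "X \<in> A" and max: "\<forall>Y\<in>A. X \<subseteq> Y \<longrightarrow> X = Y"
    using finite_has_maximal[of A] by blast
  from XA have X: "X \<subseteq> pverts G" "X \<noteq> {}" "path_connected_within X" "P X"
    by (auto simp: A_def)
  have "X = pverts G"
  proof (rule ccontr)
    assume "X \<noteq> pverts G"
    then obtain a b where "a \<in> X" "b \<in> pverts G - X"
      using X by blast
    then obtain p where "a \<in> X" "b \<notin> X" "awalk a p b"
      using X walk[of a b] by blast
    then obtain q x where qx: "q \<in> X" "x \<notin> X" "(q, x) \<in> parcs G"
      using awalk_crosses_boundary by blast
    have xV: "x \<in> pverts G" using qx(3) by (rule in_arcsD2)
    have "P (insert x X)"
      using X qx xV unique_neighbour_within[OF acyclic] by (intro extend[of X q x]) auto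
    moreover have "path_connected_within (insert x X)"
      using X qx by (intro path_connected_within_insert) auto
    ultimately have "insert x X \<in> A"
      using X xV by (auto simp: A_def)
    then show False
      using max qx(2) by blast
  qed
  then show ?thesis
    using X by simp
qed

section \<open>Labelling a tree with prescribed differences\<close>

text \<open>
  A new leaf \<open>x\<close> at \<open>q\<close> receives the label of \<open>q\<close> plus an element of \<open>S\<close> that is not yet a difference
  at \<open>q\<close>. It exists because \<open>x\<close> is a neighbour of \<open>q\<close> without a label, so that fewer than \<open>card S\<close>
  differences are in use. Seen from \<open>x\<close>, the difference to \<open>q\<close> lies in \<open>S\<close> by symmetry.
\<close>

lemma undirected_tree_difference_labelling:
  fixes G :: "'a pair_pre_digraph" and S :: "'b::ab_group_add set"
  assumes T: "undirected_tree G" and minus: "\<And>s. s \<in> S \<Longrightarrow> - s \<in> S"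
    and deg: "\<And>v. v \<in> pverts G \<Longrightarrow> out_degree (with_proj G) v \<le> card S"
  obtains f :: "'a \<Rightarrow> 'b" where "\<And>v u. (v, u) \<in> parcs G \<Longrightarrow> f u - f v \<in> S"
    and "\<And>v. inj_on f (parcs G `` {v})"
proof -
  interpret pair_graph G
    using T by (simp add: undirected_tree_def)
  let ?N = "\<lambda>v X. parcs G `` {v} \<inter> X"
  have "\<exists>f :: 'a \<Rightarrow> 'b. \<forall>v\<in>pverts G. inj_on f (?N v (pverts G)) \<and>
      (\<forall>u\<in>?N v (pverts G). f u - f v \<in> S)"
    using T
  proof (induction rule: undirected_tree_induct)
    case (single r)
    then show ?case
      using pair_no_loops[of "(r, r)"] by (auto simp: inj_on_def)
  next
    case (extend X q x)
    from extend.IH obtain f :: "'a \<Rightarrow> 'b"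
      where f: "\<forall>v\<in>X. inj_on f (?N v X) \<and> (\<forall>u\<in>?N v X. f u - f v \<in> S)" ..
    have inj: "inj_on f (?N v X)" if "v \<in> X" for v
      using f that by simp
    have diff: "f u - f v \<in> S" if "v \<in> X" "u \<in> ?N v X" for v u
      using f that by simp
    have qX: "q \<in> X" and xX: "x \<notin> X" and qV: "q \<in> pverts G" and qx: "(q, x) \<in> parcs G"
      using extend.hyps by blast+
    then have neq: "q \<noteq> x"
      by blast
    have uniq: "y = q" if "y \<in> X" "(y, x) \<in> parcs G" for y
      using that by (rule extend.hyps(5))
    have "card ((\<lambda>u. f u - f q) ` ?N q X) \<le> card (?N q X)"
      using finite_Image_parcs[of q] by (intro card_image_le) auto
    also have "\<dots> < card (parcs G `` {q})"
      using qx xX by (intro psubset_card_mono finite_Image_parcs) blast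
    also have "\<dots> \<le> card S"
      using qV deg[of q] by (simp add: out_degree_eq_card_Image)
    finally have "\<not> S \<subseteq> (\<lambda>u. f u - f q) ` ?N q X"
      using finite_Image_parcs[of q] card_mono[of "(\<lambda>u. f u - f q) ` ?N q X" S] by auto
    then obtain s where s: "s \<in> S" "\<And>u. u \<in> ?N q X \<Longrightarrow> s \<noteq> f u - f q"
      by blast
    let ?f = "f(x := f q + s)"
    have "inj_on ?f (?N v (insert x X)) \<and> (\<forall>u\<in>?N v (insert x X). ?f u - ?f v \<in> S)"
      if v: "v \<in> insert x X" for v
    proof -
      consider "v = x" | "v = q" | "v \<in> X" "v \<noteq> q"
        using v by auto
      then show ?thesis
      proof cases
        case 1
        have "?N x (insert x X) = {q}"
        proof (intro equalityI subsetI)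
          fix y assume y: "y \<in> ?N x (insert x X)"
          then have "(y, x) \<in> parcs G"
            by (simp add: arcs_symmetric)
          moreover from this have "y \<in> X"
            using y pair_no_loops[of "(x, x)"] by auto
          ultimately show "y \<in> {q}"
            using uniq by simp
        qed (use qX arcs_symmetric[OF qx] in simp)
        then show ?thesis
          using 1 neq minus[OF s(1)] by simp
      next
        case 2
        have N: "?N q (insert x X) = insert x (?N q X)"
          using qx by auto
        have "inj_on ?f (?N q X)"
          using inj[OF qX] xX by (subst inj_on_cong[of _ _ f]) auto
        moreover have "f q + s \<noteq> f u" if "u \<in> ?N q X" for u
          using s(2)[OF that] by (metis add_diff_cancel_left')
        ultimately show ?thesis
          using 2 N diff[OF qX] xX s(1) neq by (auto simp: image_iff)
      next
        case 3
        have N: "?N v (insert x X) = ?N v X"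
          using uniq[OF 3(1)] 3(2) by blast
        have "inj_on ?f (?N v X)"
          using inj[OF 3(1)] xX by (subst inj_on_cong[of _ _ f]) auto
        then show ?thesis
          using 3 N diff[OF 3(1)] xX by auto
      qed
    qed
    then show ?case
      by (intro exI[of _ ?f] ballI)
  qed
  then obtain f :: "'a \<Rightarrow> 'b" where f: "\<forall>v\<in>pverts G. inj_on f (?N v (pverts G)) \<and>
      (\<forall>u\<in>?N v (pverts G). f u - f v \<in> S)" ..
  have N: "?N v (pverts G) = parcs G `` {v}" for v
    by (auto dest: in_arcsD2)
  show ?thesis
  proof (rule that)
    show "f u - f v \<in> S" if "(v, u) \<in> parcs G" for v u
      using that f by (auto dest: in_arcsD1 in_arcsD2)
    show "inj_on f (parcs G `` {v})" for v
    proof (cases "v \<in> pverts G")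
      case False
      then have "parcs G `` {v} = {}" by (auto dest: in_arcsD1)
      then show ?thesis by simp
    qed (use f N in simp)
  qed
qed

section \<open>Colouring the square of a product\<close>

text \<open>
  Summing the labels modulo \<open>2 K + 1\<close> gives the colouring. On \<open>[-K, K]\<close> congruence modulo \<open>2 K + 1\<close> is
  equality. Hence a difference of colours along an edge is nonzero, and it determines the
  coordinate of the edge, by disjointness, and then the end of the edge, by injectivity.
\<close>

lemma chromatic_number_square_cartesian_product_le:
  fixes G :: "'i \<Rightarrow> 'a pair_pre_digraph" and f :: "'i \<Rightarrow> 'a \<Rightarrow> int"
  assumes "finite I" and G: "\<And>i. i \<in> I \<Longrightarrow> pair_graph (G i)"
    and S: "\<And>i. i \<in> I \<Longrightarrow> S i \<subseteq> {- int K..int K} - {0}"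
    and disj: "\<And>i j. i \<in> I \<Longrightarrow> j \<in> I \<Longrightarrow> i \<noteq> j \<Longrightarrow> S i \<inter> S j = {}"
    and diff: "\<And>i v u. i \<in> I \<Longrightarrow> (v, u) \<in> parcs (G i) \<Longrightarrow> f i u - f i v \<in> S i"
    and inj: "\<And>i v. i \<in> I \<Longrightarrow> inj_on (f i) (parcs (G i) `` {v})"
  shows "chromatic_number (square (cartesian_product I G)) \<le> 2 * K + 1"
proof -
  let ?H = "cartesian_product I G"
  let ?M = "2 * int K + 1"
  define F where "F v = (\<Sum>i\<in>I. f i (v i))" for v
  interpret H: pair_graph ?H
    using assms(1) G by (rule pair_graph_cartesian_product)
  have mod_eqD: "s = t" if "s mod ?M = t mod ?M" "\<bar>s\<bar> \<le> int K" "\<bar>t\<bar> \<le> int K" for s t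
  proof -
    have "?M dvd s - t"
      using that(1) by (simp add: mod_eq_dvd_iff)
    moreover have "\<bar>s - t\<bar> < ?M"
      using that(2,3) by linarith
    ultimately show ?thesis
      using dvd_imp_le_int[of "s - t" ?M] by fastforce
  qed
  have step: "\<exists>i\<in>I. (u i, v i) \<in> parcs (G i) \<and> (\<forall>j\<in>I. j \<noteq> i \<longrightarrow> u j = v j) \<and>
      F v - F u = f i (v i) - f i (u i)" if "(u, v) \<in> parcs ?H" for u v
  proof -
    obtain i where i: "i \<in> I" "(u i, v i) \<in> parcs (G i)" "\<forall>j\<in>I. j \<noteq> i \<longrightarrow> u j = v j"
      using \<open>(u, v) \<in> parcs ?H\<close> by (auto simp: cartesian_product_def)
    have "(\<Sum>j\<in>I - {i}. f j (u j)) = (\<Sum>j\<in>I - {i}. f j (v j))"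
      using i(3) by (intro sum.cong) auto
    then have "F v - F u = f i (v i) - f i (u i)"
      unfolding F_def using assms(1) i(1) by (simp add: sum.remove[of I i])
    then show ?thesis
      using i by blast
  qed
  have adjacent: "F v mod ?M \<noteq> F w mod ?M" if vw: "(v, w) \<in> parcs ?H" for v w
  proof
    assume eq: "F v mod ?M = F w mod ?M"
    obtain i where i: "i \<in> I" "F w - F v \<in> S i"
      using step[OF vw] diff by auto
    have "(F w - F v) mod ?M = (F v - F v) mod ?M"
      using eq[symmetric] by (rule mod_diff_cong) simp
    moreover have "F w - F v \<in> {- int K..int K} - {0}"
      using S[OF i(1)] i(2) by blast
    ultimately show False
      using mod_eqD[of "F w - F v" 0] by (auto simp: abs_le_iff)
  qed
  have common: "v = w" if uv: "(u, v) \<in> parcs ?H" and uw: "(u, w) \<in> parcs ?H"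
    and eq: "F v mod ?M = F w mod ?M" for u v w
  proof -
    obtain i where i: "i \<in> I" "(u i, v i) \<in> parcs (G i)" "\<forall>l\<in>I. l \<noteq> i \<longrightarrow> u l = v l"
        "F v - F u = f i (v i) - f i (u i)"
      using step[OF uv] by auto
    obtain j where j: "j \<in> I" "(u j, w j) \<in> parcs (G j)" "\<forall>l\<in>I. l \<noteq> j \<longrightarrow> u l = w l"
        "F w - F u = f j (w j) - f j (u j)"
      using step[OF uw] by auto
    have Si: "F v - F u \<in> S i" and Sj: "F w - F u \<in> S j"
      using i j diff by auto
    have "(F v - F u) mod ?M = (F w - F u) mod ?M"
      using eq by (rule mod_diff_cong) simp
    moreover have "\<bar>F v - F u\<bar> \<le> int K" "\<bar>F w - F u\<bar> \<le> int K"
      using subsetD[OF S[OF i(1)] Si] subsetD[OF S[OF j(1)] Sj] by (auto simp: abs_le_iff)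
    ultimately have same: "F v - F u = F w - F u"
      by (rule mod_eqD)
    then have ij: "i = j"
      using disj[OF i(1) j(1)] Si Sj by auto
    have "v i = w i"
      using inj_onD[OF inj[OF i(1)], of "v i" "w i" "u i"] same i j ij by auto
    moreover have "v \<in> (\<Pi>\<^sub>E i\<in>I. pverts (G i))" "w \<in> (\<Pi>\<^sub>E i\<in>I. pverts (G i))"
      using uv uw by (auto simp: cartesian_product_def)
    ultimately show "v = w"
      using i(3) j(3) ij by (metis PiE_ext)
  qed
  have "colouring (square ?H) (\<lambda>v. F v mod ?M)"
    unfolding colouring_def square_def
    using adjacent common H.arcs_symmetric by simp blast
  moreover have "(\<lambda>v. F v mod ?M) ` pverts (square ?H) \<subseteq> {0..<?M}"
    using pos_mod_sign[of ?M] pos_mod_bound[of ?M] by (intro image_subsetI) simp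
  ultimately have "chromatic_number (square ?H) \<le> card {0..<?M}"
    by (rule chromatic_number_le) simp
  then show ?thesis
    by (simp add: nat_add_distrib nat_mult_distrib)
qed

text \<open>
  The integers \<open>s\<close> with \<open>1 \<le> \<bar>s\<bar> \<le> \<Sum> k i\<close> are cut by size, so that each block contains \<open>- s\<close>
  together with \<open>s\<close>: the \<open>i\<close>-th block lets \<open>\<bar>s\<bar>\<close> run through the \<open>k i\<close> integers that follow
  \<open>\<Sum>j<i. k j\<close>.
\<close>

lemma symmetric_blocks:
  fixes k :: "nat \<Rightarrow> nat"
  obtains S :: "nat \<Rightarrow> int set" where "\<And>i s. s \<in> S i \<Longrightarrow> - s \<in> S i"
    and "\<And>i. card (S i) = 2 * k i"
    and "\<And>i. i < n \<Longrightarrow> S i \<subseteq> {- int (\<Sum>i<n. k i)..int (\<Sum>i<n. k i)} - {0}"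
    and "\<And>i j. i \<noteq> j \<Longrightarrow> S i \<inter> S j = {}"
proof -
  define a where "a i = sum k {..<i}" for i
  define S where "S i = {int (a i)<..int (a (Suc i))} \<union> {- int (a (Suc i))..<- int (a i)}" for i
  have mem: "s \<in> S i \<longleftrightarrow> int (a i) < \<bar>s\<bar> \<and> \<bar>s\<bar> \<le> int (a (Suc i))" for s i
    unfolding S_def by auto
  have mono: "a i \<le> a j" if "i \<le> j" for i j
    unfolding a_def using that by (intro sum_mono2) auto
  show ?thesis
  proof (rule that[of S])
    show "- s \<in> S i" if "s \<in> S i" for s i
      using that by (simp add: mem)
    have "a (Suc i) = a i + k i" for i
      by (simp add: a_def)
    then show "card (S i) = 2 * k i" for i
      unfolding S_def by (subst card_Un_disjoint) auto
    show "S i \<subseteq> {- int (\<Sum>i<n. k i)..int (\<Sum>i<n. k i)} - {0}" if "i < n" for i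
      using mono[of "Suc i" n] that unfolding a_def[of n, symmetric] by (auto simp: mem)
    show "S i \<inter> S j = {}" if "i \<noteq> j" for i j
      using mono[of "Suc i" j] mono[of "Suc j" i] that by (cases "i < j") (auto simp: mem)
  qed
qed

theorem theorem1:
  fixes d :: nat and T :: "nat \<Rightarrow> 'a pair_pre_digraph" and G :: "(nat \<Rightarrow> 'a) pair_pre_digraph"
  assumes "d \<ge> 1"
    and "\<And>i. i \<in> {1..d} \<Longrightarrow> undirected_tree (T i)"
    and "\<And>i. i \<in> {1..d} \<Longrightarrow> parcs (T i) \<noteq> {}"
    and "G = cartesian_product {1..d} T"
  shows "1 + (\<Sum>i = 1..d. int (max_degree (T i))) \<le> int (chromatic_number (square G)) \<and>
    int (chromatic_number (square G))
      \<le> 1 + 2 * (\<Sum>i = 1..d. \<lceil>1 / 2 * real (max_degree (T i))\<rceil>)"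
proof
  have graph: "pair_graph (T i)" if "i \<in> {1..d}" for i
    using assms(2)[OF that] by (simp add: undirected_tree_def)
  have graphG: "pair_graph G"
    unfolding assms(4) using graph by (intro pair_graph_cartesian_product) auto
  show "1 + (\<Sum>i = 1..d. int (max_degree (T i))) \<le> int (chromatic_number (square G))"
  proof -
    have "\<exists>v. v \<in> pverts (T i) \<and> out_degree (with_proj (T i)) v = max_degree (T i)"
      if i: "i \<in> {1..d}" for i
    proof -
      interpret pair_graph "T i" by (rule graph[OF i])
      have "pverts (T i) \<noteq> {}"
        using assms(3)[OF i] arc_fst_in_verts by blast
      then show ?thesis
        using max_degree_attained by blast
    qed
    then obtain m where m: "\<And>i. i \<in> {1..d} \<Longrightarrow> m i \<in> pverts (T i)"
        "\<And>i. i \<in> {1..d} \<Longrightarrow> out_degree (with_proj (T i)) (m i) = max_degree (T i)"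
      by metis
    let ?v = "restrict m {1..d}"
    have v: "?v \<in> pverts G"
      unfolding assms(4) using m by (auto simp: cartesian_product_def)
    have "(\<Sum>i = 1..d. max_degree (T i)) = out_degree (with_proj G) ?v"
      using out_degree_cartesian_product[of "{1..d}" T ?v] v graph m assms(4) by simp
    then show ?thesis
      using Suc_out_degree_le_chromatic_number_square[OF graphG v]
      by (simp flip: of_nat_sum)
  qed
  show "int (chromatic_number (square G))
      \<le> 1 + 2 * (\<Sum>i = 1..d. \<lceil>1 / 2 * real (max_degree (T i))\<rceil>)"
  proof -
    define k where "k i = nat \<lceil>1 / 2 * real (max_degree (T i))\<rceil>" for i
    have int_k: "int (k i) = \<lceil>1 / 2 * real (max_degree (T i))\<rceil>" for i
      unfolding k_def by (simp add: ceiling_le_iff order_less_le_trans)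
    have deg_k: "max_degree (T i) \<le> 2 * k i" for i
      unfolding k_def by linarith
    \<comment> \<open>The blocks are indexed from 0, the trees from 1.\<close>
    have sum_k: "(\<Sum>i<d. k (Suc i)) = (\<Sum>i = 1..d. k i)"
      by (simp add: sum.atLeast1_atMost_eq)
    obtain S :: "nat \<Rightarrow> int set" where S: "\<And>i s. s \<in> S i \<Longrightarrow> - s \<in> S i"
        "\<And>i. card (S i) = 2 * k (Suc i)"
        "\<And>i. i < d \<Longrightarrow> S i \<subseteq> {- int (\<Sum>i = 1..d. k i)..int (\<Sum>i = 1..d. k i)} - {0}"
        "\<And>i j. i \<noteq> j \<Longrightarrow> S i \<inter> S j = {}"
      using symmetric_blocks[where n = d and k = "\<lambda>i. k (Suc i)"] unfolding sum_k by metis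
    have "\<exists>f. (\<forall>v u. (v, u) \<in> parcs (T i) \<longrightarrow> f u - f v \<in> S (i - 1)) \<and>
        (\<forall>v. inj_on f (parcs (T i) `` {v}))" if i: "i \<in> {1..d}" for i
    proof -
      interpret pair_graph "T i" by (rule graph[OF i])
      have "out_degree (with_proj (T i)) v \<le> card (S (i - 1))" if "v \<in> pverts (T i)" for v
        using out_degree_le_max_degree[OF that] deg_k[of i] S(2)[of "i - 1"] i by simp
      then show ?thesis
        using undirected_tree_difference_labelling[OF assms(2)[OF i] S(1)]
        by metis
    qed
    then obtain f where f: "\<And>i v u. i \<in> {1..d} \<Longrightarrow> (v, u) \<in> parcs (T i) \<Longrightarrow>
          f i u - f i v \<in> S (i - 1)"
        "\<And>i v. i \<in> {1..d} \<Longrightarrow> inj_on (f i) (parcs (T i) `` {v})"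
      by metis
    have "chromatic_number (square G) \<le> 2 * (\<Sum>i = 1..d. k i) + 1"
      unfolding assms(4)
    proof (rule chromatic_number_square_cartesian_product_le
        [where S = "\<lambda>i. S (i - 1)" and f = f])
      show "S (i - 1) \<subseteq> {- int (\<Sum>i = 1..d. k i)..int (\<Sum>i = 1..d. k i)} - {0}"
        if "i \<in> {1..d}" for i
        using that by (intro S(3)) auto
      show "S (i - 1) \<inter> S (j - 1) = {}" if "i \<in> {1..d}" "j \<in> {1..d}" "i \<noteq> j" for i j
        using that by (intro S(4)) auto
    qed (use graph f in auto)
    then have "int (chromatic_number (square G)) \<le> 1 + 2 * (\<Sum>i = 1..d. int (k i))"
      by (simp flip: of_nat_sum)
    then show ?thesis
      by (simp add: int_k)
  qed
qed

end
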